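(* For every normed BPA system $\mathcal{G}=(V,\mathit{Act},\mathcal{R})$ (with $V$ linearly ordered), the canonical transducer $\mathcal{T}^\mathcal{G}$ is an nfc-transducer that is consistent with $\mathcal{G}$.
   Context: BPA system $\mathcal{G}=(V,\mathit{Act},\mathcal{R})$: finite variables $V$, finite actions (possibly with silent $\tau$), rules $A\xrightarrow{a}\alpha$; LTS $\mathcal{L}_\mathcal{G}$ on $V^*$ with $A\beta\xrightarrow{a}\alpha\beta$. Normed: each variable can reach $\varepsilon$. $\sim$: branching bisimilarity in $\mathcal{L}_\mathcal{G}$ (largest relation $\mathcal{B}$ such that for $(s,t)\in\mathcal{B}$ every move $s\xrightarrow{a}s'$ is matched by $a=\tau,(s',t)\in\mathcal{B}$, or by $t=t_0\xrightarrow{\tau}\cdots\xrightarrow{\tau}t_k\xrightarrow{a}t'$ with $(s',t')\in\mathcal{B}$, $(s,t_i)\in\mathcal{B}$, $i\in[1,k]$; and symmetrically). Transducer $\mathcal{T}=(Q,V,\Delta,q_0)$, $\Delta:Q\times V\to Q\times V^*$, read right to left: $q'\xleftarrow{A/\gamma}q$ means $\Delta(q,A)=(q',\gamma)$; extended by $q\xleftarrow{\varepsilon/\varepsilon}q$ and: $q'\xleftarrow{A/\gamma}q$, $q''\xleftarrow{\alpha/\beta}q'$ give $q''\xleftarrow{\alpha A/\beta\gamma}q$. $\mathcal{T}_q(\alpha)$ = output from $q$ on $\alpha$. $q$-normal form: $\varepsilon$ or $A_k\cdots A_1$ with $q_k\xleftarrow{A_k/A_k}\cdots q_1\xleftarrow{A_1/A_1}q$.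 nfc-transducer: each $\mathcal{T}_q(A)$ is a $q$-normal form and $q'\xleftarrow{A/\gamma}q$ implies $q'\xleftarrow{\gamma/\gamma}q$. Long moves: $\alpha\overset{a}{\Rightarrow}_q\beta$ if $a=\tau$ and $\beta=\mathcal{T}_q(\alpha)$, or $\alpha=\alpha_0\xrightarrow{\tau}\cdots\xrightarrow{\tau}\alpha_k\xrightarrow{a}\beta'$ in $\mathcal{L}_\mathcal{G}$ with $\mathcal{T}_q(\alpha_0)=\cdots=\mathcal{T}_q(\alpha_k)$, $\mathcal{T}_q(\beta')=\beta$. $\alpha_1\approx_q\alpha_2$ iff for each $a$ the sets of long-move results from $\alpha_1,\alpha_2$ coincide. Consistency with $\mathcal{G}$: (1) $A\approx_{q_0}\varepsilon$ if $\mathcal{T}_{q_0}(A)=\varepsilon$; (2) $A\approx_q\mathcal{T}_q(A)$ if $\mathcal{T}_q(A)\ne\varepsilon$; (3) $AC\approx_qC$ if $\mathcal{T}_q(AC)=\mathcal{T}_q(C)=C$. Canonical transducer: $R_\gamma=\{X\in V\mid X\gamma\sim\gamma\}$; prefix $\alpha$ of $\alpha\gamma$ is redundancy-free if not of the form $\delta X\beta$ with $X\beta\gamma\sim\beta\gamma$; $\alpha$ is lexicographically smaller than $\beta$ if $\alpha$ is a proper suffix of $\beta$ or $\alpha=\alpha'A\gamma,\beta=\beta'B\gamma$ with $A<B$. $\mathcal{T}^\mathcal{G}=(Q,V,\Delta,q_0)$ with $Q=\{R_\gamma\mid\gamma\in V^*\}$, $q_0=R_\varepsilon$, $\Delta(R_\gamma,A)=(R_{A\gamma},\alpha)$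 where $\alpha$ is lexicographically smallest among the longest strings with $\alpha\gamma\sim A\gamma$ and $\alpha$ a redundancy-free prefix of $\alpha\gamma$ (this is well defined: it depends only on $R_\gamma$). *)

theory Defs
  imports Main
begin

text \<open>A BPA system is given by a set of rules R of triples (A, a, alpha), meaning
  A --a--> alpha; variables have a finite linearly ordered type 'v, actions a
  finite type 'a; tau is the designated silent action. Strings over V are lists,
  the head of a list being the leftmost symbol (the one that is rewritten).\<close>

definition bpa_step :: "('v \<times> 'a \<times> 'v list) set \<Rightarrow> 'v list \<Rightarrow> 'a \<Rightarrow> 'v list \<Rightarrow> bool" where
  "bpa_step R s a t \<longleftrightarrow> (\<exists>A alpha beta. s = A # beta \<and> (A, a, alpha) \<in> R \<and> t = alpha @ beta)"

definition normed :: "('v \<times> 'a \<times> 'v list) set \<Rightarrow> bool" where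
  "normed R \<longleftrightarrow> (\<forall>A. (\<lambda>x y. \<exists>a. bpa_step R x a y)\<^sup>*\<^sup>* [A] [])"

definition bb_half :: "('v \<times> 'a \<times> 'v list) set \<Rightarrow> 'a \<Rightarrow> ('v list \<times> 'v list) set \<Rightarrow> bool" where
  "bb_half R tau B \<longleftrightarrow> (\<forall>s t. (s, t) \<in> B \<longrightarrow> (\<forall>a s'. bpa_step R s a s' \<longrightarrow>
      (a = tau \<and> (s', t) \<in> B) \<or>
      (\<exists>tk t'. (\<lambda>x y. bpa_step R x tau y \<and> (s, y) \<in> B)\<^sup>*\<^sup>* t tk
               \<and> bpa_step R tk a t' \<and> (s', t') \<in> B)))"

definition branching_bisimulation :: "('v \<times> 'a \<times> 'v list) set \<Rightarrow> 'a \<Rightarrow> ('v list \<times> 'v list) set \<Rightarrow> bool" where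
  "branching_bisimulation R tau B \<longleftrightarrow> bb_half R tau B \<and> bb_half R tau (B\<inverse>)"

definition bbisim :: "('v \<times> 'a \<times> 'v list) set \<Rightarrow> 'a \<Rightarrow> 'v list \<Rightarrow> 'v list \<Rightarrow> bool" where
  "bbisim R tau s t \<longleftrightarrow> (\<exists>B. branching_bisimulation R tau B \<and> (s, t) \<in> B)"

text \<open>A transducer is (Q, Delta, q0) with Delta :: 'q => 'v => 'q * 'v list.
  Input is read right to left. run Delta q alpha = (q'', beta) means
  q'' <-alpha/beta- q.\<close>

definition run :: "('q \<Rightarrow> 'v \<Rightarrow> 'q \<times> 'v list) \<Rightarrow> 'q \<Rightarrow> 'v list \<Rightarrow> 'q \<times> 'v list" where
  "run Delta q alpha = foldr (\<lambda>A (p, out). case Delta p A of (p', gamma) \<Rightarrow> (p', gamma @ out)) alpha (q, [])"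

definition tout :: "('q \<Rightarrow> 'v \<Rightarrow> 'q \<times> 'v list) \<Rightarrow> 'q \<Rightarrow> 'v list \<Rightarrow> 'v list" where
  "tout Delta q alpha = snd (run Delta q alpha)"

definition normal_form :: "('q \<Rightarrow> 'v \<Rightarrow> 'q \<times> 'v list) \<Rightarrow> 'q \<Rightarrow> 'v list \<Rightarrow> bool" where
  "normal_form Delta q alpha \<longleftrightarrow>
     (\<forall>i < length alpha. snd (Delta (fst (run Delta q (drop (Suc i) alpha))) (alpha ! i)) = [alpha ! i])"

definition nfc_transducer :: "'q set \<Rightarrow> ('q \<Rightarrow> 'v \<Rightarrow> 'q \<times> 'v list) \<Rightarrow> bool" where
  "nfc_transducer Q Delta \<longleftrightarrow>
     (\<forall>q\<in>Q. \<forall>A. normal_form Delta q (snd (Delta q A))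
               \<and> run Delta q (snd (Delta q A)) = Delta q A)"

definition long_move :: "('v \<times> 'a \<times> 'v list) set \<Rightarrow> 'a \<Rightarrow> ('q \<Rightarrow> 'v \<Rightarrow> 'q \<times> 'v list) \<Rightarrow> 'q
     \<Rightarrow> 'v list \<Rightarrow> 'a \<Rightarrow> 'v list \<Rightarrow> bool" where
  "long_move R tau Delta q alpha a beta \<longleftrightarrow>
     (a = tau \<and> beta = tout Delta q alpha) \<or>
     (\<exists>alphak beta'. (\<lambda>x y. bpa_step R x tau y \<and> tout Delta q x = tout Delta q y)\<^sup>*\<^sup>* alpha alphak
        \<and> bpa_step R alphak a beta' \<and> tout Delta q beta' = beta)"

definition lm_equiv :: "('v \<times> 'a \<times> 'v list) set \<Rightarrow> 'a \<Rightarrow> ('q \<Rightarrow> 'v \<Rightarrow> 'q \<times> 'v list) \<Rightarrow> 'q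
     \<Rightarrow> 'v list \<Rightarrow> 'v list \<Rightarrow> bool" where
  "lm_equiv R tau Delta q alpha1 alpha2 \<longleftrightarrow>
     (\<forall>a. {beta. long_move R tau Delta q alpha1 a beta} = {beta. long_move R tau Delta q alpha2 a beta})"

definition consistent :: "('v \<times> 'a \<times> 'v list) set \<Rightarrow> 'a \<Rightarrow> 'q set \<Rightarrow> ('q \<Rightarrow> 'v \<Rightarrow> 'q \<times> 'v list) \<Rightarrow> 'q \<Rightarrow> bool" where
  "consistent R tau Q Delta q0 \<longleftrightarrow>
     (\<forall>A. tout Delta q0 [A] = [] \<longrightarrow> lm_equiv R tau Delta q0 [A] []) \<and>
     (\<forall>q\<in>Q. \<forall>A. tout Delta q [A] \<noteq> [] \<longrightarrow> lm_equiv R tau Delta q [A] (tout Delta q [A])) \<and>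
     (\<forall>q\<in>Q. \<forall>A C. tout Delta q [A, C] = [C] \<and> tout Delta q [C] = [C]
                   \<longrightarrow> lm_equiv R tau Delta q [A, C] [C])"

definition Rset :: "('v \<times> 'a \<times> 'v list) set \<Rightarrow> 'a \<Rightarrow> 'v list \<Rightarrow> 'v set" where
  "Rset R tau gamma = {X. bbisim R tau (X # gamma) gamma}"

definition redundancy_free :: "('v \<times> 'a \<times> 'v list) set \<Rightarrow> 'a \<Rightarrow> 'v list \<Rightarrow> 'v list \<Rightarrow> bool" where
  "redundancy_free R tau alpha gamma \<longleftrightarrow>
     \<not> (\<exists>delta X beta. alpha = delta @ X # beta \<and> bbisim R tau (X # beta @ gamma) (beta @ gamma))"

definition lex_less :: "'v::linorder list \<Rightarrow> 'v list \<Rightarrow> bool" where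
  "lex_less alpha beta \<longleftrightarrow>
     (\<exists>delta. delta \<noteq> [] \<and> beta = delta @ alpha) \<or>
     (\<exists>alpha' beta' A B gamma. alpha = alpha' @ A # gamma \<and> beta = beta' @ B # gamma \<and> A < B)"

definition can_cands :: "('v \<times> 'a \<times> 'v list) set \<Rightarrow> 'a \<Rightarrow> 'v list \<Rightarrow> 'v \<Rightarrow> 'v list set" where
  "can_cands R tau gamma A =
     {alpha. bbisim R tau (alpha @ gamma) (A # gamma) \<and> redundancy_free R tau alpha gamma}"

definition can_out :: "('v::linorder \<times> 'a \<times> 'v list) set \<Rightarrow> 'a \<Rightarrow> 'v list \<Rightarrow> 'v \<Rightarrow> 'v list" where
  "can_out R tau gamma A = (SOME alpha. alpha \<in> can_cands R tau gamma A
      \<and> (\<forall>beta \<in> can_cands R tau gamma A. length beta \<le> length alpha)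
      \<and> (\<forall>beta \<in> can_cands R tau gamma A. length beta = length alpha \<longrightarrow> beta \<noteq> alpha \<longrightarrow> lex_less alpha beta))"

definition can_Q :: "('v \<times> 'a \<times> 'v list) set \<Rightarrow> 'a \<Rightarrow> 'v set set" where
  "can_Q R tau = range (Rset R tau)"

definition can_q0 :: "('v \<times> 'a \<times> 'v list) set \<Rightarrow> 'a \<Rightarrow> 'v set" where
  "can_q0 R tau = Rset R tau []"

text \<open>Delta(R_gamma, A) = (R_{A gamma}, alpha), computed from an arbitrary representative gamma
  of the state (the paper asserts this depends only on R_gamma).\<close>
definition can_Delta :: "('v::linorder \<times> 'a \<times> 'v list) set \<Rightarrow> 'a \<Rightarrow> 'v set \<Rightarrow> 'v \<Rightarrow> 'v set \<times> 'v list" where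
  "can_Delta R tau q A = (let gamma = (SOME gamma. Rset R tau gamma = q)
                          in (Rset R tau (A # gamma), can_out R tau gamma A))"

end

theory Submission
  imports Defs
begin

text \<open>Let \<open>\<parallel>s\<parallel>\<close> be the least number of class-changing steps on a path from \<open>s\<close> to the empty
  string; it is invariant under bisimilarity. As every path from \<open>\<alpha>\<gamma>\<close> to the empty string passes
  through \<open>\<gamma>\<close>, we have \<open>\<parallel>\<alpha>\<gamma>\<parallel> \<ge> \<parallel>\<gamma>\<parallel>\<close>, with equality only if \<open>\<alpha>\<gamma> \<sim> \<gamma>\<close>. So \<open>\<alpha>\<gamma> \<sim> \<gamma>\<close>
  iff all variables of \<open>\<alpha>\<close> lie in \<open>R\<^sub>\<gamma>\<close>, whence the relation \<open>\<alpha>\<gamma> \<sim> \<beta>\<gamma>\<close> depends on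
  \<open>R\<^sub>\<gamma>\<close> only, and redundancy-free prefixes of bisimilar strings are bounded in length. If
  \<open>\<alpha>X\<gamma> \<sim> \<beta>Y\<gamma>\<close> with \<open>\<parallel>X\<gamma>\<parallel> \<le> \<parallel>Y\<gamma>\<parallel>\<close>, then a cheapest descent to \<open>Y\<gamma>\<close> is
  matched by a path from \<open>\<alpha>X\<gamma>\<close> to some \<open>\<kappa>X\<gamma> \<sim> Y\<gamma>\<close>; the maximal length of outputs forces
  \<open>X\<gamma> \<sim> Y\<gamma>\<close>, hence normal forms are unique in each class. Thus equality of outputs is
  bisimilarity, and long moves simulate each other, because matching runs never consume
  \<open>\<gamma>\<close> when \<open>\<alpha>\<gamma>\<close> is not bisimilar to \<open>\<gamma>\<close>.\<close>

section \<open>Branching bisimilarity\<close>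

lemma bpa_step_Nil [simp]: "\<not> bpa_step R [] a t"
  by (simp add: bpa_step_def)

lemma bpa_step_appendI: "bpa_step R s a t \<Longrightarrow> bpa_step R (s @ u) a (t @ u)"
  by (auto simp: bpa_step_def)

lemma bpa_step_appendD:
  assumes "bpa_step R (s @ u) a t" "s \<noteq> [] \<or> u = []"
  shows "\<exists>t'. bpa_step R s a t' \<and> t = t' @ u"
  using assms by (cases s) (fastforce simp: bpa_step_def)+

lemma tau_path_appendI:
  assumes "(\<lambda>x y. bpa_step R x tau y \<and> P y)\<^sup>*\<^sup>* s t" "\<And>y. P y \<Longrightarrow> P' (y @ u)"
  shows "(\<lambda>x y. bpa_step R x tau y \<and> P' y)\<^sup>*\<^sup>* (s @ u) (t @ u)"
  using assms(1)
  by (induction rule: rtranclp_induct)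
     (auto intro: rtranclp.rtrancl_into_rtrancl bpa_step_appendI assms(2))

text \<open>All states entered satisfy \<open>P\<close>, so if \<open>P u\<close> fails the run
  never arrives at \<open>u\<close> itself; the front stays nonempty and every rewritten head lies
  in it.\<close>

lemma tau_path_appendE:
  assumes "(\<lambda>x y. bpa_step R x tau y \<and> P y)\<^sup>*\<^sup>* (s @ u) t"
    and "s \<noteq> [] \<or> u = []" and "\<not> P u \<or> u = []"
  obtains t' where "t = t' @ u" "t' \<noteq> [] \<or> u = []"
    "(\<lambda>x y. bpa_step R x tau y \<and> P (y @ u))\<^sup>*\<^sup>* s t'"
proof -
  have "\<exists>t'. t = t' @ u \<and> (t' \<noteq> [] \<or> u = [])
      \<and> (\<lambda>x y. bpa_step R x tau y \<and> P (y @ u))\<^sup>*\<^sup>* s t'"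
    using assms(1)
  proof (induction rule: rtranclp_induct)
    case base
    then show ?case using assms(2) by blast
  next
    case (step y z)
    then obtain y' where y': "y = y' @ u" "y' \<noteq> [] \<or> u = []"
      "(\<lambda>x y. bpa_step R x tau y \<and> P (y @ u))\<^sup>*\<^sup>* s y'"
      by blast
    with bpa_step_appendD[of R y' u tau z] step.hyps obtain z' where "bpa_step R y' tau z'" "z = z' @ u"
      by auto
    moreover from this step.hyps assms(3) have "z' \<noteq> [] \<or> u = []"
      by auto
    ultimately show ?case
      using y'(3) step.hyps(2) by (metis (mono_tags, lifting) rtranclp.rtrancl_into_rtrancl)
  qed
  then show thesis using that by blast
qed

lemma bb_halfD:
  assumes "bb_half R tau B" "(s, t) \<in> B" "bpa_step R s a s'"
  shows "(a = tau \<and> (s', t) \<in> B) \<or>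
      (\<exists>tk t'. (\<lambda>x y. bpa_step R x tau y \<and> (s, y) \<in> B)\<^sup>*\<^sup>* t tk
               \<and> bpa_step R tk a t' \<and> (s', t') \<in> B)"
  using assms unfolding bb_half_def by blast

lemma bb_half_mono_path:
  assumes "(\<lambda>x y. bpa_step R x tau y \<and> (s, y) \<in> B)\<^sup>*\<^sup>* t u" "B \<subseteq> C"
  shows "(\<lambda>x y. bpa_step R x tau y \<and> (s, y) \<in> C)\<^sup>*\<^sup>* t u"
  using assms(1) by (rule rtranclp_mono[THEN predicate2D, rotated]) (use assms(2) in blast)

lemma bb_half_Union:
  assumes "\<And>B. B \<in> M \<Longrightarrow> bb_half R tau B"
  shows "bb_half R tau (\<Union>M)"
  unfolding bb_half_def
proof (intro allI impI, elim UnionE)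
  fix s t a s' B
  assume B: "B \<in> M" "(s, t) \<in> B" and "bpa_step R s a s'"
  with assms have "(a = tau \<and> (s', t) \<in> B) \<or>
      (\<exists>tk t'. (\<lambda>x y. bpa_step R x tau y \<and> (s, y) \<in> B)\<^sup>*\<^sup>* t tk
               \<and> bpa_step R tk a t' \<and> (s', t') \<in> B)"
    by (intro bb_halfD)
  with B(1) show "(a = tau \<and> (s', t) \<in> \<Union>M) \<or>
      (\<exists>tk t'. (\<lambda>x y. bpa_step R x tau y \<and> (s, y) \<in> \<Union>M)\<^sup>*\<^sup>* t tk
               \<and> bpa_step R tk a t' \<and> (s', t') \<in> \<Union>M)"
    using bb_half_mono_path[of R tau s B t _ "\<Union>M"] by blast
qed

text \<open>Each tau step of the run in \<open>B\<close> is either absorbed by \<open>C\<close> or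
  answered by a run of its own; the answers are concatenated. Carrying
  \<open>(s, t') \<in> B\<close> along is what relates the states inside these answers to
  \<open>s\<close>.\<close>

lemma bb_half_relcomp_path:
  assumes "(\<lambda>x y. bpa_step R x tau y \<and> (s, y) \<in> B)\<^sup>*\<^sup>* t t'"
    and C: "bb_half R tau C" and "(s, t) \<in> B" "(t, u) \<in> C"
  shows "\<exists>u'. (\<lambda>x y. bpa_step R x tau y \<and> (s, y) \<in> B O C)\<^sup>*\<^sup>* u u' \<and> (t', u') \<in> C \<and> (s, t') \<in> B"
  using assms(1)
proof (induction rule: rtranclp_induct)
  case base
  then show ?case using assms(3,4) by blast
next
  case (step y z)
  then obtain v where v: "(\<lambda>x y. bpa_step R x tau y \<and> (s, y) \<in> B O C)\<^sup>*\<^sup>* u v"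
    "(y, v) \<in> C" "(s, y) \<in> B" by blast
  from step.hyps have z: "bpa_step R y tau z" "(s, z) \<in> B" by auto
  from bb_halfD[OF C v(2) z(1)] consider "(z, v) \<in> C"
    | vk v' where "(\<lambda>x w. bpa_step R x tau w \<and> (y, w) \<in> C)\<^sup>*\<^sup>* v vk" "bpa_step R vk tau v'" "(z, v') \<in> C"
    by blast
  then show ?case
  proof cases
    case 1
    then show ?thesis using v z by blast
  next
    case 2
    have "(\<lambda>x w. bpa_step R x tau w \<and> (s, w) \<in> B O C)\<^sup>*\<^sup>* v vk"
      using 2(1) by (rule rtranclp_mono[THEN predicate2D, rotated]) (use v(3) in blast)
    with v(1) have "(\<lambda>x w. bpa_step R x tau w \<and> (s, w) \<in> B O C)\<^sup>*\<^sup>* u vk"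
      by (rule rtranclp_trans)
    moreover have "bpa_step R vk tau v' \<and> (s, v') \<in> B O C"
      using 2 z by blast
    ultimately show ?thesis
      using 2(3) z(2) by (metis (mono_tags, lifting) rtranclp.rtrancl_into_rtrancl)
  qed
qed

lemma bb_half_relcomp:
  assumes B: "bb_half R tau B" and C: "bb_half R tau C"
  shows "bb_half R tau (B O C)"
  unfolding bb_half_def
proof (intro allI impI)
  fix s u a s'
  assume "(s, u) \<in> B O C" and st: "bpa_step R s a s'"
  then obtain t where t: "(s, t) \<in> B" "(t, u) \<in> C" by blast
  let ?P = "\<lambda>x y. bpa_step R x tau y \<and> (s, y) \<in> B O C"
  from bb_halfD[OF B t(1) st] consider "a = tau" "(s', t) \<in> B"
    | tk t' where "(\<lambda>x w. bpa_step R x tau w \<and> (s, w) \<in> B)\<^sup>*\<^sup>* t tk" "bpa_step R tk a t'" "(s', t') \<in> B"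
    by blast
  then show "(a = tau \<and> (s', u) \<in> B O C) \<or>
      (\<exists>tk t'. ?P\<^sup>*\<^sup>* u tk \<and> bpa_step R tk a t' \<and> (s', t') \<in> B O C)"
  proof cases
    case 1
    then show ?thesis using t by blast
  next
    case 2
    from bb_half_relcomp_path[OF 2(1) C t] obtain v where
      v: "?P\<^sup>*\<^sup>* u v" "(tk, v) \<in> C" "(s, tk) \<in> B" by blast
    from bb_halfD[OF C v(2) 2(2)] consider "a = tau" "(t', v) \<in> C"
      | vk v' where "(\<lambda>x w. bpa_step R x tau w \<and> (tk, w) \<in> C)\<^sup>*\<^sup>* v vk" "bpa_step R vk a v'" "(t', v') \<in> C"
      by blast
    then show ?thesis
    proof cases
      case a: 1
      \<comment> \<open>\<open>C\<close> absorbs the last tau step, so \<open>v\<close> already is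
        the required target. If the run from \<open>u\<close> to \<open>v\<close> is empty, the
        composite absorbs the step too; otherwise the last step of that run serves as the answering
        step.\<close>
      from v(1) show ?thesis
      proof (cases rule: rtranclp.cases)
        case rtrancl_refl
        then show ?thesis using a 2 by blast
      next
        case (rtrancl_into_rtrancl w)
        then show ?thesis using a 2 by blast
      qed
    next
      case b: 2
      have "?P\<^sup>*\<^sup>* v vk"
        using b(1) by (rule rtranclp_mono[THEN predicate2D, rotated]) (use v(3) in blast)
      with v(1) have "?P\<^sup>*\<^sup>* u vk" by (rule rtranclp_trans)
      then show ?thesis using b 2 by blast
    qed
  qed
qed

lemma bb_half_Id: "bb_half R tau Id"
  unfolding bb_half_def by blast

lemma bbisim_symI:
  assumes "bb_half R tau B" "sym B" "(s, t) \<in> B"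
  shows "bbisim R tau s t"
proof -
  have "B\<inverse> = B" using assms(2) by (simp add: sym_conv_converse_eq)
  then show ?thesis using assms unfolding bbisim_def branching_bisimulation_def by metis
qed

lemma bbisim_refl [simp]: "bbisim R tau s s"
  by (rule bbisim_symI[OF bb_half_Id sym_Id]) simp

lemma bbisim_sym: "bbisim R tau s t \<Longrightarrow> bbisim R tau t s"
  unfolding bbisim_def branching_bisimulation_def by (metis converse_converse converse_iff)

lemma bbisim_trans:
  assumes "bbisim R tau s t" "bbisim R tau t u"
  shows "bbisim R tau s u"
proof -
  obtain B C where B: "branching_bisimulation R tau B" "(s, t) \<in> B"
    and C: "branching_bisimulation R tau C" "(t, u) \<in> C"
    using assms by (auto simp: bbisim_def)
  then have "branching_bisimulation R tau (B O C)"
    by (simp add: branching_bisimulation_def converse_relcomp bb_half_relcomp)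
  then show ?thesis using B(2) C(2) by (auto simp: bbisim_def)
qed

lemma bb_half_bbisim: "bb_half R tau {(s, t). bbisim R tau s t}"
proof -
  have "{(s, t). bbisim R tau s t} = \<Union>{B. branching_bisimulation R tau B}"
    by (auto simp: bbisim_def)
  then show ?thesis
    using bb_half_Union[of "{B. branching_bisimulation R tau B}" R tau]
    by (auto simp: branching_bisimulation_def)
qed

lemma bbisim_stepE:
  assumes "bbisim R tau s t" "bpa_step R s a s'"
  obtains "a = tau" "bbisim R tau s' t"
  | tk t' where "(\<lambda>x y. bpa_step R x tau y \<and> bbisim R tau s y)\<^sup>*\<^sup>* t tk"
      "bpa_step R tk a t'" "bbisim R tau s' t'"
  using bb_halfD[OF bb_half_bbisim, of s t R tau a s'] assms by auto

text \<open>As long as the common prefix is nonempty both sides make the same move; once it is used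
  up, bisimilarity of the remainders takes over.\<close>

lemma bbisim_append_left:
  assumes "bbisim R tau s t"
  shows "bbisim R tau (u @ s) (u @ t)"
proof (rule bbisim_symI)
  let ?B = "{(u @ s, u @ t) |u s t. bbisim R tau s t}"
  show "sym ?B" by (auto intro!: symI dest: bbisim_sym)
  show "(u @ s, u @ t) \<in> ?B" using assms by blast
  show "bb_half R tau ?B"
    unfolding bb_half_def
  proof (intro allI impI)
    fix s t a s'
    assume "(s, t) \<in> ?B" and st: "bpa_step R s a s'"
    then obtain u x y where u: "s = u @ x" "t = u @ y" "bbisim R tau x y" by blast
    have sub: "{(s, t). bbisim R tau s t} \<subseteq> ?B"
      by (clarify, rule exI[of _ "[]"]) simp
    show "(a = tau \<and> (s', t) \<in> ?B) \<or>
      (\<exists>tk t'. (\<lambda>x y. bpa_step R x tau y \<and> (s, y) \<in> ?B)\<^sup>*\<^sup>* t tk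
               \<and> bpa_step R tk a t' \<and> (s', t') \<in> ?B)"
    proof (cases "u = []")
      case True
      then have "(s, t) \<in> {(s, t). bbisim R tau s t}" using u by simp
      from bb_halfD[OF bb_half_bbisim this st] sub show ?thesis
        using bb_half_mono_path[OF _ sub, of R tau s t] by blast
    next
      case False
      with bpa_step_appendD[of R u x a s'] st u obtain u' where u': "bpa_step R u a u'" "s' = u' @ x"
        by auto
      then have "bpa_step R t a (u' @ y)" "(s', u' @ y) \<in> ?B"
        using u by (auto intro: bpa_step_appendI)
      then show ?thesis by blast
    qed
  qed
qed

section \<open>Normed systems\<close>

locale normed_bpa =
  fixes R :: "('v \<times> 'a \<times> 'v list) set" and tau :: 'a
  assumes normed: "normed R"
begin

abbreviation bisimilar :: "'v list \<Rightarrow> 'v list \<Rightarrow> bool" (infix "\<sim>" 50)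
  where "s \<sim> t \<equiv> bbisim R tau s t"

lemma path_appendI:
  assumes "(\<lambda>x y. \<exists>a. bpa_step R x a y)\<^sup>*\<^sup>* s t"
  shows "(\<lambda>x y. \<exists>a. bpa_step R x a y)\<^sup>*\<^sup>* (s @ u) (t @ u)"
  using assms
proof (induction rule: rtranclp_induct)
  case (step y z)
  then have "\<exists>a. bpa_step R (y @ u) a (z @ u)" by (blast intro: bpa_step_appendI)
  with step.IH show ?case by (rule rtranclp.rtrancl_into_rtrancl)
qed simp

lemma reaches_Nil: "(\<lambda>x y. \<exists>a. bpa_step R x a y)\<^sup>*\<^sup>* s []"
proof (induction s)
  case (Cons A s)
  have "(\<lambda>x y. \<exists>a. bpa_step R x a y)\<^sup>*\<^sup>* [A] []"
    using normed by (simp add: normed_def)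
  then have "(\<lambda>x y. \<exists>a. bpa_step R x a y)\<^sup>*\<^sup>* ([A] @ s) ([] @ s)"
    by (rule path_appendI)
  with Cons show ?case by simp
qed simp

text \<open>The empty string has no moves, so every move of a string bisimilar to it must be an
  absorbed tau step. Hence any path to \<open>[]\<close>, which exists by normedness, is
  inert.\<close>

lemma bbisim_Nil_tau_path:
  assumes "s \<sim> []"
  shows "(\<lambda>x y. bpa_step R x tau y \<and> [] \<sim> y)\<^sup>*\<^sup>* s []"
  using reaches_Nil[of s] assms
proof (induction rule: converse_rtranclp_induct)
  case (step y z)
  then obtain a where a: "bpa_step R y a z" by blast
  have "a = tau \<and> z \<sim> []"
    using \<open>y \<sim> []\<close> a
    by (rule bbisim_stepE) (auto elim: converse_rtranclpE)
  with a have "bpa_step R y tau z \<and> [] \<sim> z" by (simp add: bbisim_sym)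
  moreover have "(\<lambda>x y. bpa_step R x tau y \<and> [] \<sim> y)\<^sup>*\<^sup>* z []"
    using step.IH \<open>a = tau \<and> z \<sim> []\<close> by blast
  ultimately show ?case by (rule converse_rtranclp_into_rtranclp)
qed simp

subsection \<open>The class-change norm\<close>

text \<open>The number is a budget, not an exact count: \<open>cpath_refl\<close> may leave some of
  it unspent, and \<open>cpath_change\<close> may also pay for an inert step. Steps within a class
  are free whatever their action.\<close>

inductive cpath :: "'v list \<Rightarrow> nat \<Rightarrow> 'v list \<Rightarrow> bool" where
  cpath_refl: "cpath s n s"
| cpath_inert: "bpa_step R s a s' \<Longrightarrow> s \<sim> s' \<Longrightarrow> cpath s' n t \<Longrightarrow> cpath s n t"
| cpath_change: "bpa_step R s a s' \<Longrightarrow> cpath s' n t \<Longrightarrow> cpath s (Suc n) t"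

definition cnorm :: "'v list \<Rightarrow> nat" where
  "cnorm s = (LEAST n. cpath s n [])"

lemma cpath_mono: "cpath s m t \<Longrightarrow> m \<le> n \<Longrightarrow> cpath s n t"
proof (induction arbitrary: n rule: cpath.induct)
  case (cpath_change s a s' m t)
  then show ?case by (cases n) (auto intro: cpath.intros)
qed (auto intro: cpath.intros)

lemma cpath_trans: "cpath s m t \<Longrightarrow> cpath t n u \<Longrightarrow> cpath s (m + n) u"
proof (induction rule: cpath.induct)
  case (cpath_refl s m)
  then show ?case by (rule cpath_mono) simp
qed (auto intro: cpath.intros)

lemma cpath_0_bbisim: "cpath s n t \<Longrightarrow> n = 0 \<Longrightarrow> s \<sim> t"
  by (induction rule: cpath.induct) (auto intro: bbisim_trans)

lemma tau_path_cpath: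
  assumes "(\<lambda>x y. bpa_step R x tau y \<and> s \<sim> y)\<^sup>*\<^sup>* t u" "s \<sim> t"
  shows "cpath t 0 u"
  using assms
proof (induction rule: converse_rtranclp_induct)
  case (step y z)
  then show ?case by (meson bbisim_sym bbisim_trans cpath_inert)
qed (rule cpath_refl)

text \<open>A free step is simulated by staying put, a paid one by staying put or by a free tau run
  followed by one paid step. So the budget carries over, with the end state fixed only up to
  bisimilarity.\<close>

lemma cpath_bbisim:
  assumes "cpath s n t" "s \<sim> s2"
  shows "\<exists>t2. t \<sim> t2 \<and> cpath s2 n t2"
  using assms
proof (induction arbitrary: s2 rule: cpath.induct)
  case (cpath_refl s n)
  then show ?case using cpath.cpath_refl by blast
next
  case (cpath_inert s a s' n t)
  then show ?case by (meson bbisim_sym bbisim_trans)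
next
  case (cpath_change s a s' n t)
  from \<open>s \<sim> s2\<close> \<open>bpa_step R s a s'\<close> show ?case
  proof (rule bbisim_stepE)
    assume "s' \<sim> s2"
    then show ?thesis using cpath_change.IH cpath_mono by (meson le_SucI order_refl)
  next
    fix sk s2'
    assume path: "(\<lambda>x y. bpa_step R x tau y \<and> s \<sim> y)\<^sup>*\<^sup>* s2 sk"
      and sk: "bpa_step R sk a s2'" "s' \<sim> s2'"
    from path cpath_change.prems have "cpath s2 0 sk" by (rule tau_path_cpath)
    moreover from sk cpath_change.IH obtain t2 where t2: "t \<sim> t2" "cpath s2' n t2" by blast
    moreover from sk t2 have "cpath sk (Suc n) t2" by (blast intro: cpath.cpath_change)
    ultimately show ?thesis using cpath_trans[of s2 0 sk "Suc n" t2] by auto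
  qed
qed

text \<open>Only the front is rewritten until it is used up. Either \<open>v\<close> survives as a
  suffix of the end state, or the path visits \<open>v\<close> and the budget splits there.\<close>

lemma cpath_append_cases:
  assumes "cpath s n t" "s = u @ v"
  shows "(\<exists>w. t = w @ v) \<or> (\<exists>m k. m + k = n \<and> cpath s m v \<and> cpath v k t)"
  using assms
proof (induction arbitrary: u rule: cpath.induct)
  case (cpath_inert s a s' n t)
  show ?case
  proof (cases "u = []")
    case True
    then show ?thesis
      using cpath_inert.prems cpath_inert.hyps
      by (intro disjI2 exI[of _ 0] exI[of _ n]) (auto intro: cpath.intros)
  next
    case False
    with bpa_step_appendD[of R u v a s'] cpath_inert.hyps cpath_inert.prems obtain u' where "s' = u' @ v"
      by auto
    from cpath_inert.IH[OF this] cpath_inert.hyps show ?thesis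
      by (blast intro: cpath.cpath_inert)
  qed
next
  case (cpath_change s a s' n t)
  show ?case
  proof (cases "u = []")
    case True
    then show ?thesis
      using cpath_change.prems cpath_change.hyps
      by (intro disjI2 exI[of _ 0] exI[of _ "Suc n"]) (auto intro: cpath.intros)
  next
    case False
    with bpa_step_appendD[of R u v a s'] cpath_change.hyps cpath_change.prems obtain u' where "s' = u' @ v"
      by auto
    from cpath_change.IH[OF this] cpath_change.hyps show ?thesis
      by (metis add_Suc cpath.cpath_change)
  qed
qed blast

lemma cpath_cnorm: "cpath s (cnorm s) []"
proof -
  have "\<exists>n. cpath s n []"
    using reaches_Nil[of s]
    by (induction rule: converse_rtranclp_induct) (blast intro: cpath.intros)+
  then show ?thesis unfolding cnorm_def by (rule LeastI_ex)
qed

lemma cnorm_le: "cpath s n [] \<Longrightarrow> cnorm s \<le> n"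
  unfolding cnorm_def by (rule Least_le)

lemma cnorm_le_cpath: "cpath s n t \<Longrightarrow> cnorm s \<le> n + cnorm t"
  by (rule cnorm_le, erule cpath_trans, rule cpath_cnorm)

lemma cnorm_bbisim:
  assumes "s \<sim> t"
  shows "cnorm s = cnorm t"
proof -
  \<comment> \<open>The simulating path ends in some \<open>t2\<close> bisimilar to
    \<open>[]\<close>, and \<open>bbisim_Nil_tau_path\<close> completes it to \<open>[]\<close> at
    no cost.\<close>
  have "cnorm t \<le> cnorm s" if st: "s \<sim> t" for s t
  proof -
    from cpath_bbisim[OF cpath_cnorm st] obtain t2 where
      t2: "[] \<sim> t2" "cpath t (cnorm s) t2" by blast
    have "cpath t2 0 []"
      by (rule tau_path_cpath[OF bbisim_Nil_tau_path[OF bbisim_sym[OF t2(1)]] t2(1)])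
    from cpath_trans[OF t2(2) this] have "cpath t (cnorm s) []" by simp
    then show ?thesis by (rule cnorm_le)
  qed
  from this[OF assms] this[OF bbisim_sym[OF assms]] show ?thesis by simp
qed

lemma cnorm_append_split:
  obtains m where "cpath (s @ t) m t" "m + cnorm t \<le> cnorm (s @ t)"
proof -
  from cpath_append_cases[OF cpath_cnorm refl[of "s @ t"]] show thesis
  proof (elim disjE exE conjE)
    \<comment> \<open>Here \<open>t\<close> is empty and has norm 0, so the whole path to
      \<open>[]\<close> is itself the descent to \<open>t\<close>.\<close>
    fix w assume "[] = w @ t"
    moreover have "cnorm [] \<le> 0" by (rule cnorm_le[OF cpath_refl])
    ultimately show thesis using that[of "cnorm (s @ t)"] cpath_cnorm[of "s @ t"] by auto
  next
    fix m k
    assume "m + k = cnorm (s @ t)" "cpath (s @ t) m t" "cpath t k []"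
    then show thesis using that[of m] cnorm_le[of t k] by auto
  qed
qed

lemma cnorm_append_mono: "cnorm t \<le> cnorm (s @ t)"
  by (rule cnorm_append_split[of s t]) simp

lemma bbisim_append_iff_cnorm: "s @ t \<sim> t \<longleftrightarrow> cnorm (s @ t) \<le> cnorm t"
proof
  show "s @ t \<sim> t \<Longrightarrow> cnorm (s @ t) \<le> cnorm t" by (simp add: cnorm_bbisim)
next
  assume "cnorm (s @ t) \<le> cnorm t"
  moreover obtain m where "cpath (s @ t) m t" "m + cnorm t \<le> cnorm (s @ t)"
    by (rule cnorm_append_split)
  ultimately show "s @ t \<sim> t" by (intro cpath_0_bbisim[of _ m]) simp_all
qed

text \<open>The norm of \<open>t @ u\<close> is squeezed between those of \<open>u\<close> and
  \<open>s @ t @ u\<close>, which coincide.\<close>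

lemma bbisim_append_suffix: "s @ t @ u \<sim> u \<Longrightarrow> t @ u \<sim> u"
  using bbisim_append_iff_cnorm[of "s @ t" u] bbisim_append_iff_cnorm[of t u]
    cnorm_append_mono[of "t @ u" s] by simp

lemma bbisim_Rset_iff: "s @ t \<sim> t \<longleftrightarrow> set s \<subseteq> Rset R tau t"
proof (induction s)
  case (Cons X s)
  have "(X # s) @ t \<sim> t \<longleftrightarrow> X # t \<sim> t \<and> s @ t \<sim> t"
  proof -
    have "X # s @ t \<sim> X # t" if "s @ t \<sim> t"
      using bbisim_append_left[OF that, of "[X]"] by simp
    then show ?thesis
      using bbisim_append_suffix[of "[X]" s t] by (auto intro: bbisim_trans bbisim_sym)
  qed
  with Cons show ?case by (auto simp: Rset_def)
qed simp

lemma Rset_cong: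
  assumes "s \<sim> t"
  shows "Rset R tau s = Rset R tau t"
proof -
  have "X # s \<sim> s \<longleftrightarrow> X # t \<sim> t" for X
  proof -
    have "X # s \<sim> X # t" using bbisim_append_left[OF assms, of "[X]"] by simp
    with assms show ?thesis by (blast intro: bbisim_trans bbisim_sym)
  qed
  then show ?thesis by (simp add: Rset_def)
qed

subsection \<open>Bisimilarity relative to a context\<close>

text \<open>If \<open>s @ u\<close> is not bisimilar to \<open>u\<close>, the intermediate states of the matching run have
  not consumed \<open>u\<close>, so the run lives in front of \<open>u\<close>.\<close>
lemma bbisim_append_stepE:
  assumes "s @ u \<sim> t @ u" and st: "bpa_step R s a s'" and u: "\<not> s @ u \<sim> u \<or> u = []"
  obtains "a = tau" "s' @ u \<sim> t @ u"
  | tk t' where "(\<lambda>x y. bpa_step R x tau y \<and> s @ u \<sim> y @ u)\<^sup>*\<^sup>* t tk"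
      "bpa_step R tk a t'" "s' @ u \<sim> t' @ u"
  using assms(1) bpa_step_appendI[OF st]
proof (rule bbisim_stepE[where thesis = thesis])
  fix tk t'
  assume t: "(\<lambda>x y. bpa_step R x tau y \<and> s @ u \<sim> y)\<^sup>*\<^sup>* (t @ u) tk"
    "bpa_step R tk a t'" "s' @ u \<sim> t'"
  have "t \<noteq> [] \<or> u = []" using assms by auto
  from tau_path_appendE[OF t(1) this u] obtain v where
    v: "tk = v @ u" "v \<noteq> [] \<or> u = []" "(\<lambda>x y. bpa_step R x tau y \<and> s @ u \<sim> y @ u)\<^sup>*\<^sup>* t v" by blast
  with bpa_step_appendD[of R v u a t'] t obtain v' where "bpa_step R v a v'" "t' = v' @ u"
    by auto
  with v t that(2) show thesis by blast
qed (use that(1) in blast)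

text \<open>The witness relation transplants pairs from the context \<open>u\<close> to the context
  \<open>v\<close>. Pairs bisimilar to \<open>u\<close> consist of variables in the common
  \<open>Rset\<close> and collapse to \<open>v\<close>; for all others the matching run never
  consumes \<open>u\<close> and can be replayed in front of \<open>v\<close>.\<close>

lemma bbisim_context:
  assumes "Rset R tau u = Rset R tau v" "s @ u \<sim> t @ u"
  shows "s @ v \<sim> t @ v"
proof (rule bbisim_symI)
  let ?B = "{(s @ v, t @ v) |s t. s @ u \<sim> t @ u} \<union> {(s, t). s \<sim> t}"
  show "sym ?B" by (auto intro!: symI dest: bbisim_sym)
  show "(s @ v, t @ v) \<in> ?B" using assms by blast
  show "bb_half R tau ?B"
    unfolding bb_half_def
  proof (intro allI impI)
    fix s t a s'
    assume B: "(s, t) \<in> ?B" and st: "bpa_step R s a s'"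
    have sub: "{(s, t). s \<sim> t} \<subseteq> ?B" by blast
    show "(a = tau \<and> (s', t) \<in> ?B) \<or>
      (\<exists>tk t'. (\<lambda>x y. bpa_step R x tau y \<and> (s, y) \<in> ?B)\<^sup>*\<^sup>* t tk
               \<and> bpa_step R tk a t' \<and> (s', t') \<in> ?B)"
    proof (cases "s \<sim> t")
      case True
      then have "(s, t) \<in> {(s, t). s \<sim> t}" by simp
      from bb_halfD[OF bb_half_bbisim this st] sub show ?thesis
        using bb_half_mono_path[OF _ sub, of R tau s t] by blast
    next
      case False
      with B obtain x y where xy: "s = x @ v" "t = y @ v" "x @ u \<sim> y @ u" by blast
      have nu: "\<not> x @ u \<sim> u"
      proof
        assume x: "x @ u \<sim> u"
        have "y @ u \<sim> u" by (rule bbisim_trans[OF bbisim_sym[OF xy(3)] x])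
        with x have "x @ v \<sim> v" "y @ v \<sim> v" by (simp_all add: bbisim_Rset_iff assms(1))
        from bbisim_trans[OF this(1) bbisim_sym[OF this(2)]] False xy(1,2) show False by simp
      qed
      then have "x \<noteq> []" by auto
      with bpa_step_appendD[of R x v a s'] st xy obtain x' where x': "bpa_step R x a x'" "s' = x' @ v"
        by auto
      from xy(3) x'(1) disjI1[OF nu] show ?thesis
      proof (rule bbisim_append_stepE)
        assume "a = tau" "x' @ u \<sim> y @ u"
        then show ?thesis using xy x' by blast
      next
        fix yk y'
        assume y: "(\<lambda>w z. bpa_step R w tau z \<and> x @ u \<sim> z @ u)\<^sup>*\<^sup>* y yk"
          "bpa_step R yk a y'" "x' @ u \<sim> y' @ u"
        have "(\<lambda>w z. bpa_step R w tau z \<and> (s, z) \<in> ?B)\<^sup>*\<^sup>* (y @ v) (yk @ v)"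
          by (rule tau_path_appendI[OF y(1)]) (use xy in blast)
        moreover have "bpa_step R (yk @ v) a (y' @ v)" "(s', y' @ v) \<in> ?B"
          using y x' by (auto intro: bpa_step_appendI)
        ultimately show ?thesis using xy by blast
      qed
    qed
  qed
qed

lemma bbisim_context_iff:
  "Rset R tau u = Rset R tau v \<Longrightarrow> s @ u \<sim> t @ u \<longleftrightarrow> s @ v \<sim> t @ v"
  using bbisim_context by metis

lemma Rset_append_cong:
  "Rset R tau u = Rset R tau v \<Longrightarrow> Rset R tau (s @ u) = Rset R tau (s @ v)"
  unfolding Rset_def[of _ _ "s @ _"] using bbisim_context_iff[of u v "_ # s" s] by simp

section \<open>Redundancy-free prefixes\<close>

lemma redundancy_free_Nil [simp]: "redundancy_free R tau [] u"
  by (simp add: redundancy_free_def)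

lemma redundancy_free_Cons:
  "redundancy_free R tau (X # s) u \<longleftrightarrow> X \<notin> Rset R tau (s @ u) \<and> redundancy_free R tau s u"
  by (auto simp: redundancy_free_def Rset_def Cons_eq_append_conv)

lemma redundancy_free_append:
  "redundancy_free R tau (s @ t) u \<longleftrightarrow> redundancy_free R tau s (t @ u) \<and> redundancy_free R tau t u"
  by (induction s) (auto simp: redundancy_free_Cons)

lemma redundancy_free_cong:
  "Rset R tau u = Rset R tau v \<Longrightarrow> redundancy_free R tau s u \<longleftrightarrow> redundancy_free R tau s v"
  by (induction s) (auto simp: redundancy_free_Cons dest: Rset_append_cong)

text \<open>Going from right to left, a variable is dropped when it is redundant in front of what
  has been kept so far.\<close>

lemma redundancy_free_exists:
  obtains t where "t @ u \<sim> s @ u" "redundancy_free R tau t u"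
proof -
  have "\<exists>t. t @ u \<sim> s @ u \<and> redundancy_free R tau t u"
  proof (induction s)
    case Nil
    show ?case by (rule exI[of _ "[]"]) simp
  next
    case (Cons X s)
    then obtain t where t: "t @ u \<sim> s @ u" "redundancy_free R tau t u" by blast
    then have X: "X # t @ u \<sim> X # s @ u" using bbisim_append_left[of R tau "t @ u" "s @ u" "[X]"] by simp
    show ?case
    proof (cases "X \<in> Rset R tau (t @ u)")
      case True
      then have "t @ u \<sim> X # t @ u" by (simp add: Rset_def bbisim_sym)
      then have "t @ u \<sim> X # s @ u" using X by (rule bbisim_trans)
      with t(2) show ?thesis by auto
    next
      case False
      with t X have "(X # t) @ u \<sim> (X # s) @ u \<and> redundancy_free R tau (X # t) u"
        by (simp add: redundancy_free_Cons)
      then show ?thesis by blast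
    qed
  qed
  then show thesis using that by blast
qed

text \<open>Every variable that is not redundant raises the norm by at least one. This bounds the
  length of candidates, so that a longest one exists.\<close>

lemma redundancy_free_length:
  "redundancy_free R tau s u \<Longrightarrow> length s + cnorm u \<le> cnorm (s @ u)"
proof (induction s)
  case (Cons X s)
  then have "\<not> [X] @ s @ u \<sim> s @ u" by (simp add: redundancy_free_Cons Rset_def)
  then have "cnorm (s @ u) < cnorm (X # s @ u)"
    using bbisim_append_iff_cnorm[of "[X]" "s @ u"] by simp
  with Cons show ?case by (simp add: redundancy_free_Cons)
qed simp

lemma can_cands_cong:
  assumes "Rset R tau u = Rset R tau v"
  shows "can_cands R tau u A = can_cands R tau v A"
  unfolding can_cands_def
  using bbisim_context_iff[OF assms, of _ "[A]"] redundancy_free_cong[OF assms] by simp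

end

section \<open>The canonical transducer\<close>

lemma lex_less_append: "lex_less s t \<Longrightarrow> lex_less (s @ u) (t @ u)"
  unfolding lex_less_def by (elim disjE exE conjE; simp; blast)

lemma lex_less_snoc: "a < b \<Longrightarrow> lex_less (s @ [a]) (t @ [b])"
  unfolding lex_less_def by blast

lemma lex_less_middle:
  assumes "lex_less (s @ x # t) (s @ y # t)"
  shows "x < y"
proof -
  \<comment> \<open>Equal lengths rule out the proper-suffix alternative of \<open>lex_less\<close>;
    the position witnessing the other one must be where \<open>x\<close> and \<open>y\<close>
    stand.\<close>
  have "\<not> (\<exists>w. w \<noteq> [] \<and> s @ y # t = w @ s @ x # t)"
    by (auto dest!: arg_cong[of _ _ length])
  with assms obtain s1 s2 a b u where
    eq: "s @ x # t = s1 @ a # u" "s @ y # t = s2 @ b # u" and ab: "a < b"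
    unfolding lex_less_def by blast
  have len: "length s1 = length s2"
    using eq[THEN arg_cong[of _ _ length]] by simp
  have "(s @ x # t) ! length s1 = a" "(s @ y # t) ! length s1 = b"
    using eq len by (auto simp: nth_append)
  then show ?thesis
    using ab by (auto simp: nth_append nth_Cons split: if_splits nat.splits)
qed

text \<open>Comparison starts at the right end: take the least last letter \<open>a\<close>, then a
  least front among the strings ending in \<open>a\<close>.\<close>

lemma lex_least_exists:
  fixes S :: "'v::{finite,linorder} list set"
  assumes "S \<noteq> {}" "\<And>s. s \<in> S \<Longrightarrow> length s = n"
  shows "\<exists>m\<in>S. \<forall>s\<in>S. s \<noteq> m \<longrightarrow> lex_less m s"
  using assms
proof (induction n arbitrary: S)
  case 0
  then show ?case by fastforce
next
  case (Suc n)
  define a where "a = Min (last ` S)"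
  define S' where "S' = {s. s @ [a] \<in> S}"
  have snoc: "s = butlast s @ [last s]" if "s \<in> S" for s
    using Suc.prems(2)[OF that] by (cases s rule: rev_cases) auto
  have "a \<in> last ` S" unfolding a_def using Suc.prems(1) by (intro Min_in) auto
  then obtain s where "s \<in> S" "last s = a" by blast
  with snoc[of s] have "butlast s \<in> S'" by (simp add: S'_def)
  then have "S' \<noteq> {}" by blast
  moreover have "length s = n" if "s \<in> S'" for s
    using Suc.prems(2)[of "s @ [a]"] that by (simp add: S'_def)
  ultimately have "\<exists>m\<in>S'. \<forall>s\<in>S'. s \<noteq> m \<longrightarrow> lex_less m s" by (rule Suc.IH)
  then obtain m where m: "m \<in> S'" "\<And>s. s \<in> S' \<Longrightarrow> s \<noteq> m \<Longrightarrow> lex_less m s"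
    by blast
  have "lex_less (m @ [a]) s" if s: "s \<in> S" "s \<noteq> m @ [a]" for s
  proof (cases "last s = a")
    case True
    then have eq: "s = butlast s @ [a]" using snoc s(1) by metis
    with s have "butlast s \<in> S'" "butlast s \<noteq> m" by (auto simp: S'_def)
    with m(2) have "lex_less (m @ [a]) (butlast s @ [a])" by (intro lex_less_append) blast
    with eq show ?thesis by simp
  next
    case False
    moreover have "a \<le> last s" unfolding a_def using s by (intro Min_le) auto
    ultimately have "lex_less (m @ [a]) (butlast s @ [last s])"
      by (intro lex_less_snoc) simp
    then show ?thesis using snoc[OF s(1)] by simp
  qed
  then show ?case using m(1) unfolding S'_def by blast
qed

section \<open>Runs and normal forms of arbitrary transducers\<close>

lemma run_Nil [simp]: "run D q [] = (q, [])"
  by (simp add: run_def)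

lemma run_Cons:
  "run D q (A # s) = (fst (D (fst (run D q s)) A), snd (D (fst (run D q s)) A) @ snd (run D q s))"
  by (simp add: run_def split_beta)

lemma normal_form_Nil [simp]: "normal_form D q []"
  by (simp add: normal_form_def)

lemma normal_form_Cons:
  "normal_form D q (A # s) \<longleftrightarrow> snd (D (fst (run D q s)) A) = [A] \<and> normal_form D q s"
  by (auto simp: normal_form_def nth_Cons less_Suc_eq_0_disj)

lemma fst_run_append: "fst (run D q (s @ t)) = fst (run D (fst (run D q t)) s)"
  by (induction s) (auto simp: run_Cons)

lemma normal_form_append:
  "normal_form D q (s @ t) \<longleftrightarrow> normal_form D (fst (run D q t)) s \<and> normal_form D q t"
  by (induction s) (auto simp: normal_form_Cons fst_run_append)

lemma normal_form_tout: "normal_form D q s \<Longrightarrow> tout D q s = s"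
  by (induction s) (auto simp: normal_form_Cons tout_def run_Cons)

section \<open>Canonical outputs of single variables\<close>

locale ordered_normed_bpa = normed_bpa R tau
  for R :: "('v::{finite,linorder} \<times> 'a \<times> 'v list) set" and tau :: 'a
begin

lemma can_cands_iff:
  "s \<in> can_cands R tau u A \<longleftrightarrow> s @ u \<sim> A # u \<and> redundancy_free R tau s u"
  by (simp add: can_cands_def)

lemma can_out_ex:
  "\<exists>s. s \<in> can_cands R tau u A
      \<and> (\<forall>t \<in> can_cands R tau u A. length t \<le> length s)
      \<and> (\<forall>t \<in> can_cands R tau u A. length t = length s \<longrightarrow> t \<noteq> s \<longrightarrow> lex_less s t)"
proof -
  let ?C = "can_cands R tau u A"
  obtain s0 where "s0 @ u \<sim> [A] @ u" "redundancy_free R tau s0 u"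
    by (rule redundancy_free_exists)
  then have s0: "s0 \<in> ?C" by (simp add: can_cands_iff)
  have bound: "length s \<le> cnorm (A # u)" if "s \<in> ?C" for s
    using that redundancy_free_length[of s u] cnorm_bbisim[of "s @ u" "A # u"]
    by (simp add: can_cands_iff)
  define n where "n = Max (length ` ?C)"
  have fin: "finite (length ` ?C)"
    by (rule finite_subset[of _ "{..cnorm (A # u)}"]) (use bound in auto)
  have "n \<in> length ` ?C" unfolding n_def using fin s0 by (intro Max_in) auto
  then have "{s \<in> ?C. length s = n} \<noteq> {}" by auto
  then obtain m where "m \<in> ?C" "length m = n"
    "\<And>s. s \<in> ?C \<Longrightarrow> length s = n \<Longrightarrow> s \<noteq> m \<Longrightarrow> lex_less m s"
    using lex_least_exists[of "{s \<in> ?C. length s = n}" n] by blast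
  moreover have "length s \<le> n" if "s \<in> ?C" for s
    unfolding n_def using fin that by simp
  ultimately show ?thesis by blast
qed

lemma can_out_cands: "can_out R tau u A \<in> can_cands R tau u A"
  and can_out_longest: "s \<in> can_cands R tau u A \<Longrightarrow> length s \<le> length (can_out R tau u A)"
  and can_out_lex: "s \<in> can_cands R tau u A \<Longrightarrow> length s = length (can_out R tau u A)
    \<Longrightarrow> s \<noteq> can_out R tau u A \<Longrightarrow> lex_less (can_out R tau u A) s"
  using someI_ex[OF can_out_ex[of u A]] unfolding can_out_def[symmetric] by blast+

lemma can_out_bbisim: "can_out R tau u A @ u \<sim> A # u"
  and can_out_redundancy_free: "redundancy_free R tau (can_out R tau u A) u"
  using can_out_cands[of u A] by (simp_all add: can_cands_iff)

lemma can_out_cong: "Rset R tau u = Rset R tau v \<Longrightarrow> can_out R tau u A = can_out R tau v A"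
  unfolding can_out_def by (simp only: can_cands_cong[of u v])

lemma can_out_bbisim_cong:
  assumes "A # u \<sim> B # u"
  shows "can_out R tau u A = can_out R tau u B"
proof -
  have "can_cands R tau u A = can_cands R tau u B"
    using bbisim_trans[OF _ assms] bbisim_trans[OF _ bbisim_sym[OF assms]]
    by (auto simp: can_cands_iff)
  then show ?thesis unfolding can_out_def by simp
qed

lemma can_out_single_notin_Rset: "can_out R tau u A = [A] \<Longrightarrow> A \<notin> Rset R tau u"
  using can_out_redundancy_free[of u A] by (simp add: redundancy_free_Cons)

text \<open>The choice of representative is immaterial because next state and output both depend on
  \<open>Rset R tau u\<close> only. From here on, states are handled through any convenient
  \<open>u\<close>.\<close>

lemma can_Delta_Rset: "can_Delta R tau (Rset R tau u) A = (Rset R tau (A # u), can_out R tau u A)"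
proof -
  define v where "v = (SOME v. Rset R tau v = Rset R tau u)"
  have v: "Rset R tau v = Rset R tau u" unfolding v_def by (rule someI) simp
  have "can_Delta R tau (Rset R tau u) A = (Rset R tau (A # v), can_out R tau v A)"
    by (simp add: can_Delta_def v_def Let_def)
  then show ?thesis using Rset_append_cong[OF v, of "[A]"] can_out_cong[OF v] by simp
qed

lemma fst_run_can_Delta: "fst (run (can_Delta R tau) (Rset R tau u) s) = Rset R tau (s @ u)"
  by (induction s) (auto simp: run_Cons can_Delta_Rset)

text \<open>Replacing \<open>X\<close> inside the output for \<open>A\<close> by its own output
  \<open>k\<close> again gives a candidate for \<open>A\<close>. Maximal length on both sides forces
  \<open>k\<close> to be a single variable, and minimality on both sides forces it to be
  \<open>X\<close>.\<close>

lemma can_out_middle: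
  assumes "can_out R tau u A = s @ X # t"
  shows "can_out R tau (t @ u) X = [X]"
proof -
  define k where "k = can_out R tau (t @ u) X"
  have subst: "s @ r @ t \<in> can_cands R tau u A" if r: "r \<in> can_cands R tau (t @ u) X" for r
  proof -
    have r': "r @ t @ u \<sim> X # t @ u" "redundancy_free R tau r (t @ u)"
      using r by (simp_all add: can_cands_iff)
    have "s @ r @ t @ u \<sim> s @ X # t @ u" by (rule bbisim_append_left) (rule r'(1))
    moreover have "s @ X # t @ u \<sim> A # u" using can_out_bbisim[of u A] assms by simp
    ultimately have "s @ r @ t @ u \<sim> A # u" by (rule bbisim_trans)
    moreover have "redundancy_free R tau s (X # t @ u)" "redundancy_free R tau t u"
      using can_out_redundancy_free[of u A] assms
      by (simp_all add: redundancy_free_append redundancy_free_Cons)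
    \<comment> \<open>The replacement changes the context of \<open>s\<close>, but only to a
      bisimilar one with the same \<open>Rset\<close>, so \<open>s\<close> stays
      redundancy-free.\<close>
    ultimately show ?thesis
      using r' redundancy_free_cong[OF Rset_cong[OF r'(1)]]
      by (simp add: can_cands_iff redundancy_free_append)
  qed
  have "[X] \<in> can_cands R tau (t @ u) X"
    using can_out_redundancy_free[of u A] assms
    by (simp add: can_cands_iff redundancy_free_append redundancy_free_Cons)
  moreover have "s @ k @ t \<in> can_cands R tau u A"
    unfolding k_def by (rule subst[OF can_out_cands])
  ultimately have X: "[X] \<in> can_cands R tau (t @ u) X" "length k = 1"
    and kc: "s @ k @ t \<in> can_cands R tau u A"
    using can_out_longest[of "[X]" "t @ u" X] can_out_longest[of "s @ k @ t" u A] assms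
    by (auto simp: k_def)
  then obtain Y where Y: "k = [Y]" by (auto simp: length_Suc_conv)
  have "Y = X"
  proof (rule ccontr)
    assume "Y \<noteq> X"
    then have "lex_less ([] @ [Y]) ([] @ [X])"
      using can_out_lex[OF X(1)] Y by (simp add: k_def)
    then have "Y < X" by (rule lex_less_middle)
    moreover have "lex_less (s @ X # t) (s @ Y # t)"
      using can_out_lex[OF kc] Y assms \<open>Y \<noteq> X\<close> by simp
    then have "X < Y" by (rule lex_less_middle)
    ultimately show False by simp
  qed
  then show ?thesis using Y k_def by simp
qed

lemma normal_form_can_out: "normal_form (can_Delta R tau) (Rset R tau u) (can_out R tau u A)"
proof -
  \<comment> \<open>The claim is generalised to all suffixes of the output; in front of
    \<open>t\<close> the state is that of \<open>t @ u\<close>, where \<open>can_out_middle\<close>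
    applies.\<close>
  have "normal_form (can_Delta R tau) (Rset R tau u) t" if "can_out R tau u A = s @ t" for s t
    using that
  proof (induction t arbitrary: s)
    case (Cons X t)
    then show ?case
      using Cons.IH[of "s @ [X]"] can_out_middle[OF Cons.prems]
      by (simp add: normal_form_Cons fst_run_can_Delta can_Delta_Rset)
  qed simp
  from this[of "[]"] show ?thesis by simp
qed

lemma nfc_can_Delta: "nfc_transducer (can_Q R tau) (can_Delta R tau)"
proof -
  have "run (can_Delta R tau) (Rset R tau u) (can_out R tau u A)
      = (Rset R tau (A # u), can_out R tau u A)" for u A
    using normal_form_tout[OF normal_form_can_out[of u A]]
      fst_run_can_Delta[of u "can_out R tau u A"] Rset_cong[OF can_out_bbisim[of u A]]
    by (simp add: tout_def prod_eq_iff)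
  then show ?thesis
    by (auto simp: nfc_transducer_def can_Q_def can_Delta_Rset normal_form_can_out)
qed

section \<open>Outputs on strings and uniqueness of normal forms\<close>

abbreviation can_tout :: "'v list \<Rightarrow> 'v list \<Rightarrow> 'v list" where
  "can_tout u s \<equiv> tout (can_Delta R tau) (Rset R tau u) s"

lemma can_tout_Nil [simp]: "can_tout u [] = []"
  by (simp add: tout_def)

lemma can_tout_Cons: "can_tout u (X # s) = can_out R tau (s @ u) X @ can_tout u s"
  by (simp add: tout_def run_Cons fst_run_can_Delta can_Delta_Rset)

lemma can_tout_bbisim: "can_tout u s @ u \<sim> s @ u"
proof (induction s)
  case (Cons X s)
  have "can_out R tau (s @ u) X @ can_tout u s @ u \<sim> can_out R tau (s @ u) X @ s @ u"
    by (rule bbisim_append_left) (rule Cons)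
  moreover have "can_out R tau (s @ u) X @ s @ u \<sim> X # s @ u"
    by (rule can_out_bbisim)
  ultimately have "can_out R tau (s @ u) X @ can_tout u s @ u \<sim> X # s @ u"
    by (rule bbisim_trans)
  then show ?case by (simp add: can_tout_Cons)
qed simp

lemma normal_form_can_tout: "normal_form (can_Delta R tau) (Rset R tau u) (can_tout u s)"
proof (induction s)
  case (Cons X s)
  then show ?case
    using normal_form_can_out[of "s @ u" X] Rset_cong[OF can_tout_bbisim[of u s]]
    by (simp add: can_tout_Cons normal_form_append fst_run_can_Delta)
qed simp

lemma normal_form_last_unique_aux:
  assumes eq: "s @ X # u \<sim> t @ Y # u"
    and X: "can_out R tau u X = [X]" and Y: "can_out R tau u Y = [Y]"
    and le: "cnorm (X # u) \<le> cnorm (Y # u)"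
  shows "X = Y"
proof -
  \<comment> \<open>A descent to \<open>Y # u\<close> within the norm difference. Simulating it from
    \<open>s @ X # u\<close> is meant to produce a string ending in \<open>X # u\<close> and
    bisimilar to \<open>Y # u\<close>.\<close>
  obtain n where n: "cpath (t @ Y # u) n (Y # u)" "n + cnorm (Y # u) \<le> cnorm (t @ Y # u)"
    by (rule cnorm_append_split)
  from cpath_bbisim[OF n(1) bbisim_sym[OF eq]] obtain v where
    v: "Y # u \<sim> v" "cpath (s @ X # u) n v" by blast
  have "\<exists>w. Y # u \<sim> w @ X # u"
    using cpath_append_cases[OF v(2) refl]
  proof (elim disjE exE conjE)
    fix w assume "v = w @ X # u"
    then show ?thesis using v(1) by blast
  next
    \<comment> \<open>The simulation passes through \<open>X # u\<close> after spending
      \<open>m\<close>. Reaching \<open>X # u\<close>, whose norm is at most that of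
      \<open>Y # u\<close>, already costs at least \<open>n\<close>, so the rest is free and
      \<open>X # u\<close> is itself bisimilar to \<open>Y # u\<close>.\<close>
    fix m k
    assume mk: "m + k = n" "cpath (s @ X # u) m (X # u)" "cpath (X # u) k v"
    from cnorm_le_cpath[OF mk(2)] cnorm_bbisim[OF eq] n(2) le mk(1) have "k = 0" by simp
    with mk(3) have "X # u \<sim> v" by (intro cpath_0_bbisim) simp_all
    with v(1) have "Y # u \<sim> [] @ X # u" using bbisim_trans[OF v(1) bbisim_sym] by simp
    then show ?thesis by blast
  qed
  then obtain w where w: "Y # u \<sim> w @ X # u" by blast
  obtain w' where w': "w' @ X # u \<sim> w @ X # u" "redundancy_free R tau w' (X # u)"
    by (rule redundancy_free_exists)
  have "w' @ X # u \<sim> Y # u" by (rule bbisim_trans[OF w'(1) bbisim_sym[OF w]])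
  moreover have "redundancy_free R tau (w' @ [X]) u"
    using w' can_out_single_notin_Rset[OF X]
    by (simp add: redundancy_free_append redundancy_free_Cons)
  \<comment> \<open>The longest candidate for \<open>Y\<close> is \<open>[Y]\<close>, which leaves
    no room for \<open>w'\<close>.\<close>
  ultimately have c: "w' @ [X] \<in> can_cands R tau u Y" by (simp add: can_cands_iff)
  from can_out_longest[OF c] Y have "w' = []" by simp
  with c have "X # u \<sim> Y # u" by (simp add: can_cands_iff)
  from can_out_bbisim_cong[OF this] X Y show ?thesis by simp
qed

lemma normal_form_last_unique:
  assumes "s @ X # u \<sim> t @ Y # u" "can_out R tau u X = [X]" "can_out R tau u Y = [Y]"
  shows "X = Y"
  using normal_form_last_unique_aux[of s X u t Y] normal_form_last_unique_aux[of t Y u s X] assms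
  by (metis bbisim_sym nat_le_linear)

lemma normal_form_snoc:
  "normal_form (can_Delta R tau) (Rset R tau u) (s @ [X]) \<longleftrightarrow>
    normal_form (can_Delta R tau) (Rset R tau (X # u)) s \<and> can_out R tau u X = [X]"
  by (simp add: normal_form_append fst_run_can_Delta normal_form_Cons can_Delta_Rset)

lemma normal_form_bbisim_context_Nil:
  assumes "normal_form (can_Delta R tau) (Rset R tau u) s" "s @ u \<sim> u"
  shows "s = []"
proof (cases s rule: rev_cases)
  case (snoc t X)
  then show ?thesis
    using assms can_out_single_notin_Rset[of u X] bbisim_Rset_iff[of s u]
    by (simp add: normal_form_snoc)
qed

text \<open>Induction from the right end, where reading starts: the last variables agree by
  \<open>normal_form_last_unique\<close> and move into the context, hence the generalised
  \<open>u\<close>.\<close>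

lemma normal_form_unique:
  assumes "normal_form (can_Delta R tau) (Rset R tau u) s"
    "normal_form (can_Delta R tau) (Rset R tau u) t" "s @ u \<sim> t @ u"
  shows "s = t"
  using assms
proof (induction s arbitrary: t u rule: rev_induct)
  case Nil
  then show ?case using normal_form_bbisim_context_Nil bbisim_sym by fastforce
next
  case (snoc X s)
  show ?case
  proof (cases t rule: rev_cases)
    case Nil
    then show ?thesis using snoc.prems normal_form_bbisim_context_Nil[of u "s @ [X]"] by simp
  next
    case (snoc t' Y)
    with snoc.prems have "s @ X # u \<sim> t' @ Y # u" by simp
    moreover from this have "X = Y"
      using snoc.prems snoc by (auto simp: normal_form_snoc intro: normal_form_last_unique)
    ultimately show ?thesis
      using snoc.prems snoc snoc.IH[of "X # u" t'] by (simp add: normal_form_snoc)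
  qed
qed

lemma can_tout_eq_iff: "can_tout u s = can_tout u t \<longleftrightarrow> s @ u \<sim> t @ u"
proof
  assume "can_tout u s = can_tout u t"
  then show "s @ u \<sim> t @ u"
    using bbisim_trans[OF bbisim_sym[OF can_tout_bbisim[of u s]], of "t @ u"] can_tout_bbisim[of u t]
    by simp
next
  assume "s @ u \<sim> t @ u"
  with can_tout_bbisim have "can_tout u s @ u \<sim> t @ u" by (rule bbisim_trans)
  then have "can_tout u s @ u \<sim> can_tout u t @ u"
    using bbisim_sym[OF can_tout_bbisim] by (rule bbisim_trans)
  then show "can_tout u s = can_tout u t"
    by (rule normal_form_unique[OF normal_form_can_tout normal_form_can_tout])
qed


section \<open>Long moves and consistency\<close>

lemma inert_path_bbisim:
  assumes "(\<lambda>x y. bpa_step R x tau y \<and> can_tout u x = can_tout u y)\<^sup>*\<^sup>* s t"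
  shows "s @ u \<sim> t @ u"
  using assms by (induction rule: rtranclp_induct) (auto simp: can_tout_eq_iff intro: bbisim_trans)

lemma bbisim_inert_path:
  assumes "(\<lambda>x y. bpa_step R x tau y \<and> s @ u \<sim> y @ u)\<^sup>*\<^sup>* t t'" "s @ u \<sim> t @ u"
  shows "(\<lambda>x y. bpa_step R x tau y \<and> can_tout u x = can_tout u y)\<^sup>*\<^sup>* t t'"
proof -
  have "(\<lambda>x y. bpa_step R x tau y \<and> can_tout u x = can_tout u y)\<^sup>*\<^sup>* t t' \<and> s @ u \<sim> t' @ u"
    using assms(1)
  proof (induction rule: rtranclp_induct)
    case base
    then show ?case using assms(2) by blast
  next
    case (step y z)
    then have "can_tout u s = can_tout u y" "can_tout u s = can_tout u z"
      unfolding can_tout_eq_iff by blast+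
    then have "can_tout u y = can_tout u z" by simp
    with step show ?case by (metis (mono_tags, lifting) rtranclp.rtrancl_into_rtrancl)
  qed
  then show ?thesis ..
qed

text \<open>Only the final step needs an answer: the output-preserving run from \<open>s\<close>
  stays in one class, so its end \<open>sk\<close> is still bisimilar to \<open>t\<close> over
  \<open>u\<close>. An absorbed final step becomes the trivial tau long move of
  \<open>t\<close>.\<close>

lemma long_move_bbisim:
  assumes lm: "long_move R tau (can_Delta R tau) (Rset R tau u) s a r"
    and st: "s @ u \<sim> t @ u" and u: "\<not> s @ u \<sim> u \<or> u = []"
  shows "long_move R tau (can_Delta R tau) (Rset R tau u) t a r"
proof -
  let ?P = "\<lambda>x y. bpa_step R x tau y \<and> can_tout u x = can_tout u y"
  have eq: "can_tout u s = can_tout u t" using st by (simp add: can_tout_eq_iff)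
  from lm consider "a = tau" "r = can_tout u s"
    | sk s' where "?P\<^sup>*\<^sup>* s sk" "bpa_step R sk a s'" "can_tout u s' = r"
    unfolding long_move_def by blast
  then show ?thesis
  proof cases
    case 1
    then show ?thesis by (simp add: long_move_def eq)
  next
    case 2
    have s_sk: "s @ u \<sim> sk @ u" using 2(1) by (rule inert_path_bbisim)
    have sk_t: "sk @ u \<sim> t @ u" by (rule bbisim_trans[OF bbisim_sym[OF s_sk] st])
    have sk_u: "\<not> sk @ u \<sim> u \<or> u = []" using u bbisim_trans[OF s_sk] by blast
    from sk_t 2(2) sk_u show ?thesis
    proof (rule bbisim_append_stepE)
      assume a: "a = tau" "s' @ u \<sim> t @ u"
      then have "r = can_tout u t" using 2(3) can_tout_eq_iff by metis
      with a(1) show ?thesis by (simp add: long_move_def)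
    next
      fix tk t'
      assume t: "(\<lambda>x y. bpa_step R x tau y \<and> sk @ u \<sim> y @ u)\<^sup>*\<^sup>* t tk"
        "bpa_step R tk a t'" "s' @ u \<sim> t' @ u"
      from t(1) sk_t have "?P\<^sup>*\<^sup>* t tk" by (rule bbisim_inert_path)
      moreover have "can_tout u t' = r" using t(3) 2(3) can_tout_eq_iff by metis
      ultimately show ?thesis using t(2) unfolding long_move_def by blast
    qed
  qed
qed

lemma lm_equiv_bbisim:
  assumes "s @ u \<sim> t @ u" "\<not> s @ u \<sim> u \<or> u = []"
  shows "lm_equiv R tau (can_Delta R tau) (Rset R tau u) s t"
proof -
  have "\<not> t @ u \<sim> u \<or> u = []" using assms bbisim_trans[OF assms(1)] by blast
  from long_move_bbisim[OF _ bbisim_sym[OF assms(1)] this] long_move_bbisim[OF _ assms]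
  show ?thesis unfolding lm_equiv_def by blast
qed

lemma can_tout_Nil_iff: "can_tout u s = [] \<longleftrightarrow> s @ u \<sim> u"
  using can_tout_eq_iff[of u s "[]"] by simp

text \<open>All three conditions are instances of \<open>lm_equiv_bbisim\<close>. In the first the
  context is empty; in the other two the output is nonempty, so the string is not bisimilar to its
  context.\<close>

lemma consistent_can_Delta: "consistent R tau (can_Q R tau) (can_Delta R tau) (can_q0 R tau)"
  unfolding consistent_def can_Q_def can_q0_def
proof (intro conjI allI ballI impI)
  fix A
  assume "can_tout [] [A] = []"
  then show "lm_equiv R tau (can_Delta R tau) (Rset R tau []) [A] []"
    by (intro lm_equiv_bbisim) (simp_all add: can_tout_Nil_iff)
next
  fix q A
  assume "q \<in> range (Rset R tau)" and ne: "tout (can_Delta R tau) q [A] \<noteq> []"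
  then obtain u where "q = Rset R tau u" by blast
  with ne show "lm_equiv R tau (can_Delta R tau) q [A] (tout (can_Delta R tau) q [A])"
    using can_tout_bbisim[of u "[A]"] bbisim_sym
    by (auto simp: can_tout_Nil_iff intro!: lm_equiv_bbisim)
next
  fix q A C
  assume "q \<in> range (Rset R tau)"
    and C: "tout (can_Delta R tau) q [A, C] = [C] \<and> tout (can_Delta R tau) q [C] = [C]"
  then obtain u where "q = Rset R tau u" by blast
  with C show "lm_equiv R tau (can_Delta R tau) q [A, C] [C]"
    using can_tout_eq_iff[of u "[A, C]" "[C]"] can_tout_Nil_iff[of u "[A, C]"]
    by (auto intro!: lm_equiv_bbisim)
qed

end

theorem theorem4p7:
  fixes R :: "('v::{finite,linorder} \<times> 'a::finite \<times> 'v list) set" and tau :: 'a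
  assumes "finite R" and "normed R"
  shows "nfc_transducer (can_Q R tau) (can_Delta R tau)
         \<and> consistent R tau (can_Q R tau) (can_Delta R tau) (can_q0 R tau)"
proof -
  interpret ordered_normed_bpa R tau
    by unfold_locales (rule assms(2))
  show ?thesis using nfc_can_Delta consistent_can_Delta ..
qed

end
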